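(* The attractor $G$ of the IFS $\{(I\times\mathbb{R}^m;W_{i_1i_2\cdots i_m}): 1\le i_k\le N_k,\ 1\le k\le m\}$, associated with the data points $\big((x_{1,i_1},\dots,x_{m,i_m}),(y_{1,i_1},\dots,y_{m,i_m})\big)\in I\times\mathbb{R}^m$, is the graph of a continuous product function $g_1\times g_2\times\cdots\times g_m: I\to\mathbb{R}^m$ with $g_1\times g_2\times\cdots\times g_m\in\mathscr{T}$.
   Context: For $1\le k\le m$ let $\{(x_{k,i_k},y_{k,i_k})\in\mathbb{R}^2: 0\le i_k\le N_k\}$ be data with $x_{k,0}<x_{k,1}<\cdots<x_{k,N_k}$; put $I_k=[x_{k,0},x_{k,N_k}]$, $I_{k,i_k}=[x_{k,i_k-1},x_{k,i_k}]$ for $1\le i_k\le N_k$, $I=\prod_{k=1}^m I_k$, $I_{i_1\cdots i_m}=\prod_{k=1}^m I_{k,i_k}$. For $1\le i_k\le N_k$, $1\le k\le m$: - $L_{k,i_k}:I_k\to I_{k,i_k}$ is a homeomorphism with $L_{k,i_k}(x_{k,0})=x_{k,i_k-1}$, $L_{k,i_k}(x_{k,N_k})=x_{k,i_k}$ and $|L_{k,i_k}(x)-L_{k,i_k}(x')|\le c_{k,i_k}|x-x'|$ for all $x,x'\in I_k$, where $0\le c_{k,i_k}<1$; - $F_{k,i_k}:I_k\times\mathbb{R}\to\mathbb{R}$ is continuous with $F_{k,i_k}(x_{k,0},y_{k,0})=y_{k,i_k-1}$, $F_{k,i_k}(x_{k,N_k},y_{k,N_k})=y_{k,i_k}$, $|F_{k,i_k}(x,y)-F_{k,i_k}(x',y)|\le|a_{k,i_k}||x-x'|$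 and $|F_{k,i_k}(x,y)-F_{k,i_k}(x,y')|\le|b_{k,i_k}||y-y'|$ for all $x,x'\in I_k$, $y,y'\in\mathbb{R}$, for some $a_{k,i_k},b_{k,i_k}\in(-1,1)$. Define $L_{i_1\cdots i_m}(\vec{x})=(L_{1,i_1}(x_1),\dots,L_{m,i_m}(x_m))$ for $\vec{x}\in I$, $F_{i_1\cdots i_m}(\vec{x},\vec{y})=(F_{1,i_1}(x_1,y_1),\dots,F_{m,i_m}(x_m,y_m))$ for $\vec{x}\in I$, $\vec{y}\in\mathbb{R}^m$, and $W_{i_1\cdots i_m}:I\times\mathbb{R}^m\to I_{i_1\cdots i_m}\times\mathbb{R}^m$, $W_{i_1\cdots i_m}(\vec{x},\vec{y})=(L_{i_1\cdots i_m}(\vec{x}),F_{i_1\cdots i_m}(\vec{x},\vec{y}))$. The attractor $G$ is the unique nonempty compact subset of $I\times\mathbb{R}^m$ with $G=\bigcup W_{i_1\cdots i_m}(G)$, the union being over all $1\le i_k\le N_k$, $1\le k\le m$. For functions $f_k:I_k\to\mathbb{R}$, the product function is $(f_1\times\cdots\times f_m)(\vec{x})=(f_1(x_1),\dots,f_m(x_m))$. $C_{y_{k,0},y_{k,N_k}}[I_k]$ is the set of continuous $f:I_k\to\mathbb{R}$ with $f(x_{k,0})=y_{k,0}$ and $f(x_{k,N_k})=y_{k,N_k}$, and $\mathscr{T}=\{f_1\times\cdots\times f_m: f_k\in C_{y_{k,0},y_{k,N_k}}[I_k],\ 1\le k\le m\}$. *)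

theory Defs
  imports "HOL-Analysis.Analysis"
begin

text \<open>
  The finite index type \<open>'m\<close> plays the role of \<open>{1, \<dots>, m}\<close>.  The data are given by
  \<open>x k i\<close> and \<open>y k i\<close> for \<open>0 \<le> i \<le> N k\<close>; values at other indices are irrelevant.
\<close>

definition side :: "('m \<Rightarrow> nat \<Rightarrow> real) \<Rightarrow> ('m \<Rightarrow> nat) \<Rightarrow> 'm \<Rightarrow> real set" where
  "side x N k = {x k 0 .. x k (N k)}"

text \<open>Only meant for \<open>1 \<le> i\<close>.\<close>

definition subside :: "('m \<Rightarrow> nat \<Rightarrow> real) \<Rightarrow> 'm \<Rightarrow> nat \<Rightarrow> real set" where
  "subside x k i = {x k (i - 1) .. x k i}"

definition domain_box :: "('m::finite \<Rightarrow> nat \<Rightarrow> real) \<Rightarrow> ('m \<Rightarrow> nat) \<Rightarrow> (real ^ 'm) set" where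
  "domain_box x N = {v. \<forall>k. v $ k \<in> side x N k}"

definition multi_indices :: "('m \<Rightarrow> nat) \<Rightarrow> ('m \<Rightarrow> nat) set" where
  "multi_indices N = {i. \<forall>k. i k \<in> {1 .. N k}}"

definition L_map ::
  "('m::finite \<Rightarrow> nat \<Rightarrow> real \<Rightarrow> real) \<Rightarrow> ('m \<Rightarrow> nat) \<Rightarrow> real ^ 'm \<Rightarrow> real ^ 'm" where
  "L_map L i v = (\<chi> k. L k (i k) (v $ k))"

definition F_map ::
  "('m::finite \<Rightarrow> nat \<Rightarrow> real \<times> real \<Rightarrow> real) \<Rightarrow> ('m \<Rightarrow> nat)
    \<Rightarrow> real ^ 'm \<Rightarrow> real ^ 'm \<Rightarrow> real ^ 'm" where
  "F_map F i v w = (\<chi> k. F k (i k) (v $ k, w $ k))"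

definition W_map ::
  "('m::finite \<Rightarrow> nat \<Rightarrow> real \<Rightarrow> real) \<Rightarrow> ('m \<Rightarrow> nat \<Rightarrow> real \<times> real \<Rightarrow> real) \<Rightarrow> ('m \<Rightarrow> nat)
    \<Rightarrow> (real ^ 'm) \<times> (real ^ 'm) \<Rightarrow> (real ^ 'm) \<times> (real ^ 'm)" where
  "W_map L F i = (\<lambda>(v, w). (L_map L i v, F_map F i v w))"

text \<open>
  The attractor of the iterated function system \<open>{(X; W j) : j \<in> J}\<close>.  As it is a definite
  description, proving anything about it requires existence and uniqueness of such a set.
\<close>

definition attractor ::
  "'a::topological_space set \<Rightarrow> 'j set \<Rightarrow> ('j \<Rightarrow> 'a \<Rightarrow> 'a) \<Rightarrow> 'a set" where
  "attractor X J W =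
    (THE G. G \<noteq> {} \<and> compact G \<and> G \<subseteq> X \<and> G = (\<Union>j\<in>J. W j ` G))"

definition product_function ::
  "('m::finite \<Rightarrow> real \<Rightarrow> real) \<Rightarrow> real ^ 'm \<Rightarrow> real ^ 'm" where
  "product_function f v = (\<chi> k. f k (v $ k))"

text \<open>
  Functions on an interval are total functions on the reals whose values outside the interval
  are unconstrained.
\<close>

definition cont_interp ::
  "('m \<Rightarrow> nat \<Rightarrow> real) \<Rightarrow> ('m \<Rightarrow> nat \<Rightarrow> real) \<Rightarrow> ('m \<Rightarrow> nat) \<Rightarrow> 'm \<Rightarrow> (real \<Rightarrow> real) set" where
  "cont_interp x y N k =
    {f. continuous_on (side x N k) f \<and> f (x k 0) = y k 0 \<and> f (x k (N k)) = y k (N k)}"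

definition product_class ::
  "('m::finite \<Rightarrow> nat \<Rightarrow> real) \<Rightarrow> ('m \<Rightarrow> nat \<Rightarrow> real) \<Rightarrow> ('m \<Rightarrow> nat)
    \<Rightarrow> (real ^ 'm \<Rightarrow> real ^ 'm) set" where
  "product_class x y N = {product_function f | f. \<forall>k. f k \<in> cont_interp x y N k}"

definition graph_on :: "'a set \<Rightarrow> ('a \<Rightarrow> 'b) \<Rightarrow> ('a \<times> 'b) set" where
  "graph_on S h = {(v, h v) | v. v \<in> S}"

end

theory Submission imports Defs begin

text \<open>
  Every map of the system acts on each coordinate separately, and over the \<open>v\<close>-component it is a
  skew product: \<open>(v, w) \<mapsto> (L v, F v w)\<close>.  The two features are used one after the other.

  In one coordinate, an interpolating function \<open>g\<close> whose graph is invariant is a function with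
  \<open>g (L i s) = F i (s, g s)\<close> for all \<open>i\<close> and \<open>s\<close>.  The right-hand side, read as a function of
  \<open>L i s\<close>, is the Read--Bajraktarevic operator: the pieces live on consecutive subintervals and agree
  at the common knots because of the endpoint conditions, so the operator maps continuous
  interpolating functions to continuous interpolating functions.  It shrinks uniform distances by
  the factor \<open>max \<bar>b i\<bar> < 1\<close>, so Banach's theorem yields \<open>g\<close>
  (lemma \<open>exists_self_referential_function\<close>).  The product of these functions satisfies
  the same functional equation on the box, so its graph is a compact invariant set.

  The attractor is a definite description, so it remains to see that no other nonempty compact set
  is invariant.  Each map contracts the base and each fibre, and the two contractions are used separately
  (lemma \<open>attractor_skew_product_eq_graph\<close>): on an invariant compact set \<open>G\<close> the vertical
  distance to the graph attains its maximum, and this maximum is at most a factor below \<open>1\<close> times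
  another value, hence is zero; so \<open>G\<close> lies in the graph.  The same argument applied to the
  distance from the projection of \<open>G\<close> shows that this projection is the whole box.
\<close>

section \<open>Compact invariant sets of skew products\<close>

text \<open>
  The maximum of \<open>d\<close> is attained at some \<open>p\<close> and is at most \<open>C * d q \<le> C * d p\<close> with \<open>C < 1\<close>.
  The function \<open>d\<close> will be a distance to a candidate set, and \<open>q\<close> a preimage of \<open>p\<close> under one of the
  maps.
\<close>

lemma shrinking_function_eq_0:
  fixes d :: "'a::topological_space \<Rightarrow> real"
  assumes "compact K" and "continuous_on K d" and nonneg: "\<And>p. p \<in> K \<Longrightarrow> 0 \<le> d p"
    and shrink: "\<And>p. p \<in> K \<Longrightarrow> \<exists>q\<in>K. \<exists>C. 0 \<le> C \<and> C < 1 \<and> d p \<le> C * d q"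
    and "p \<in> K"
  shows "d p = 0"
proof -
  obtain m where m: "m \<in> K" "\<And>q. q \<in> K \<Longrightarrow> d q \<le> d m"
    using continuous_attains_sup[OF assms(1) _ assms(2)] \<open>p \<in> K\<close> by blast
  obtain q C where q: "q \<in> K" and C: "0 \<le> C" "C < 1" "d m \<le> C * d q"
    using shrink[OF m(1)] by blast
  have "d m \<le> C * d m"
    using C m(2)[OF q] by (meson mult_left_mono order_trans)
  then have "(1 - C) * d m \<le> 0"
    by (simp add: algebra_simps)
  then have "d m \<le> 0"
    using C(2) by (simp add: mult_le_0_iff)
  then show ?thesis
    using m(2)[OF \<open>p \<in> K\<close>] nonneg[OF \<open>p \<in> K\<close>] by linarith
qed

text \<open>
  The distance to \<open>P\<close> shrinks along the maps, since a nearest point of \<open>P\<close> is mapped into \<open>P\<close>.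
\<close>

lemma compact_subset_of_contraction_stable:
  fixes l :: "'j \<Rightarrow> 'a::heine_borel \<Rightarrow> 'a"
  assumes "compact K" and cover: "K \<subseteq> (\<Union>j\<in>J. l j ` K)"
    and "closed P" "P \<noteq> {}" "P \<subseteq> K" and stable: "\<And>j. j \<in> J \<Longrightarrow> l j ` P \<subseteq> P"
    and contr: "\<And>j. j \<in> J \<Longrightarrow>
      \<exists>C. 0 \<le> C \<and> C < 1 \<and> (\<forall>u\<in>K. \<forall>v\<in>K. dist (l j u) (l j v) \<le> C * dist u v)"
  shows "K \<subseteq> P"
proof
  fix v assume "v \<in> K"
  have "infdist v P = 0"
  proof (rule shrinking_function_eq_0[OF \<open>compact K\<close> _ _ _ \<open>v \<in> K\<close>])
    show "continuous_on K (\<lambda>v. infdist v P)"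
      by (intro continuous_intros)
    show "0 \<le> infdist p P" for p
      by (rule infdist_nonneg)
    fix p assume "p \<in> K"
    then obtain j u where j: "j \<in> J" "u \<in> K" "p = l j u"
      using cover by blast
    obtain C where C: "0 \<le> C" "C < 1" "\<forall>u\<in>K. \<forall>v\<in>K. dist (l j u) (l j v) \<le> C * dist u v"
      using contr[OF j(1)] by blast
    obtain z where z: "z \<in> P" "infdist u P = dist u z"
      using infdist_attains_inf[OF \<open>closed P\<close> \<open>P \<noteq> {}\<close>] by blast
    have "infdist p P \<le> dist (l j u) (l j z)"
      using stable[OF j(1)] z(1) j(3) by (auto intro: infdist_le)
    also have "\<dots> \<le> C * infdist u P"
      using C(3) j(2) z \<open>P \<subseteq> K\<close> by auto
    finally show "\<exists>q\<in>K. \<exists>C. 0 \<le> C \<and> C < 1 \<and> infdist p P \<le> C * infdist q P"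
      using C j(2) by blast
  qed
  then show "v \<in> P"
    using in_closed_iff_infdist_zero[OF \<open>closed P\<close> \<open>P \<noteq> {}\<close>] by blast
qed

lemma graph_on_eq_image: "graph_on S h = (\<lambda>v. (v, h v)) ` S"
  by (auto simp: graph_on_def)

text \<open>
  Comparing a point \<open>(v, w)\<close> of an invariant set with \<open>(v, h v)\<close>, which has the same base point,
  uses only the contraction along fibres; continuity of \<open>h\<close> makes this vertical distance attain its
  maximum.  The contraction of the base then forces the projection of the set to be all of \<open>K\<close>.
\<close>

lemma attractor_skew_product_eq_graph:
  fixes l :: "'j \<Rightarrow> 'a::heine_borel \<Rightarrow> 'a" and \<phi> :: "'j \<Rightarrow> 'a \<Rightarrow> 'b::metric_space \<Rightarrow> 'b"
  assumes "compact K" "K \<noteq> {}" and base: "(\<Union>j\<in>J. l j ` K) = K"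
    and cont: "continuous_on K h"
    and eqn: "\<And>j v. j \<in> J \<Longrightarrow> v \<in> K \<Longrightarrow> h (l j v) = \<phi> j v (h v)"
    and base_contr: "\<And>j. j \<in> J \<Longrightarrow>
      \<exists>C. 0 \<le> C \<and> C < 1 \<and> (\<forall>u\<in>K. \<forall>v\<in>K. dist (l j u) (l j v) \<le> C * dist u v)"
    and fibre_contr: "\<And>j v. j \<in> J \<Longrightarrow> v \<in> K \<Longrightarrow>
      \<exists>C. 0 \<le> C \<and> C < 1 \<and> (\<forall>w w'. dist (\<phi> j v w) (\<phi> j v w') \<le> C * dist w w')"
  shows "attractor (K \<times> UNIV) J (\<lambda>j (v, w). (l j v, \<phi> j v w)) = graph_on K h"
  unfolding attractor_def
proof (rule the_equality, intro conjI)
  show "graph_on K h \<noteq> {}" and "graph_on K h \<subseteq> K \<times> UNIV"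
    using \<open>K \<noteq> {}\<close> by (auto simp: graph_on_def)
  show "compact (graph_on K h)"
    unfolding graph_on_eq_image
    by (intro compact_continuous_image continuous_intros cont \<open>compact K\<close>)
  have "(\<Union>j\<in>J. (\<lambda>(v, w). (l j v, \<phi> j v w)) ` graph_on K h)
      = (\<lambda>v. (v, h v)) ` (\<Union>j\<in>J. l j ` K)"
    by (force simp: graph_on_eq_image image_UN image_image eqn)
  then show "graph_on K h = (\<Union>j\<in>J. (\<lambda>(v, w). (l j v, \<phi> j v w)) ` graph_on K h)"
    by (simp only: base graph_on_eq_image)
next
  fix G
  assume "G \<noteq> {} \<and> compact G \<and> G \<subseteq> K \<times> UNIV \<and> G = (\<Union>j\<in>J. (\<lambda>(v, w). (l j v, \<phi> j v w)) ` G)"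
  then have G: "G \<noteq> {}" "compact G" "G \<subseteq> K \<times> UNIV"
    and inv: "G = (\<Union>j\<in>J. (\<lambda>(v, w). (l j v, \<phi> j v w)) ` G)"
    by blast+
  have on_graph: "w = h v" if "(v, w) \<in> G" for v w
  proof -
    have "(\<lambda>p. dist (snd p) (h (fst p))) (v, w) = 0"
    proof (rule shrinking_function_eq_0[OF \<open>compact G\<close> _ _ _ that])
      have "fst ` G \<subseteq> K"
        using G(3) by auto
      then show "continuous_on G (\<lambda>p. dist (snd p) (h (fst p)))"
        by (intro continuous_intros continuous_on_compose2[OF cont])
    next
      fix p assume "p \<in> G"
      then obtain j q where j: "j \<in> J" "q \<in> G" "p = (l j (fst q), \<phi> j (fst q) (snd q))"
        by (subst (asm) inv) auto
      have q: "fst q \<in> K"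
        using j(2) G(3) by auto
      obtain C where C: "0 \<le> C" "C < 1"
        "\<forall>w w'. dist (\<phi> j (fst q) w) (\<phi> j (fst q) w') \<le> C * dist w w'"
        using fibre_contr[OF j(1) q] by blast
      have "dist (snd p) (h (fst p)) \<le> C * dist (snd q) (h (fst q))"
        using C(3) by (simp add: j(3) eqn[OF j(1) q])
      then show "\<exists>q\<in>G. \<exists>C. 0 \<le> C \<and> C < 1 \<and>
          dist (snd p) (h (fst p)) \<le> C * dist (snd q) (h (fst q))"
        using C(1,2) j(2) by blast
    qed simp
    then show ?thesis by simp
  qed
  have "K \<subseteq> fst ` G"
  proof (rule compact_subset_of_contraction_stable[OF \<open>compact K\<close> _ _ _ _ _ base_contr])
    show "closed (fst ` G)"
      by (intro compact_imp_closed compact_continuous_image continuous_intros G(2))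
    show "l j ` fst ` G \<subseteq> fst ` G" if "j \<in> J" for j
    proof clarify
      fix v w assume "(v, w) \<in> G"
      then have "(l j v, \<phi> j v w) \<in> G"
        using that by (subst inv) force
      then show "l j (fst (v, w)) \<in> fst ` G"
        by force
    qed
  qed (use G base in auto)
  with on_graph G(3) show "G = graph_on K h"
    by (fastforce simp: graph_on_eq_image image_iff)
qed

section \<open>Interpolation on an interval\<close>

lemma Icc_subset_Union_knots:
  fixes X :: "nat \<Rightarrow> real"
  assumes "1 \<le> n"
  shows "{X 0..X n} \<subseteq> (\<Union>i\<in>{1..n}. {X (i - 1)..X i})"
  using assms
proof (induction n rule: nat_induct_at_least)
  case base
  show ?case by simp
next
  case (Suc n)
  have "{X 0..X (Suc n)} \<subseteq> {X 0..X n} \<union> {X n..X (Suc n)}"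
    by auto
  also have "\<dots> \<subseteq> (\<Union>i\<in>{1..Suc n}. {X (i - 1)..X i})"
    using Suc.IH by (fastforce simp: atLeastAtMostSuc_conv)
  finally show ?case .
qed

text \<open>The data and maps of a single coordinate.\<close>

locale interpolation_system =
  fixes X Y :: "nat \<Rightarrow> real" and n :: nat
    and L :: "nat \<Rightarrow> real \<Rightarrow> real" and F :: "nat \<Rightarrow> real \<times> real \<Rightarrow> real" and b :: "nat \<Rightarrow> real"
  assumes n_pos: "1 \<le> n"
    and knots: "strict_mono_on {0..n} X"
    and L_homeo: "i \<in> {1..n} \<Longrightarrow> \<exists>L'. homeomorphism {X 0..X n} {X (i - 1)..X i} (L i) L'"
    and L_left: "i \<in> {1..n} \<Longrightarrow> L i (X 0) = X (i - 1)"
    and L_right: "i \<in> {1..n} \<Longrightarrow> L i (X n) = X i"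
    and F_cont: "i \<in> {1..n} \<Longrightarrow> continuous_on ({X 0..X n} \<times> UNIV) (F i)"
    and F_left: "i \<in> {1..n} \<Longrightarrow> F i (X 0, Y 0) = Y (i - 1)"
    and F_right: "i \<in> {1..n} \<Longrightarrow> F i (X n, Y n) = Y i"
    and b_less_1: "i \<in> {1..n} \<Longrightarrow> \<bar>b i\<bar> < 1"
    and F_lip: "i \<in> {1..n} \<Longrightarrow> s \<in> {X 0..X n} \<Longrightarrow>
      \<bar>F i (s, t) - F i (s, t')\<bar> \<le> \<bar>b i\<bar> * \<bar>t - t'\<bar>"
begin

lemma knot_le: "i \<le> j \<Longrightarrow> j \<le> n \<Longrightarrow> X i \<le> X j"
  using strict_mono_on_imp_mono_on[OF knots] by (auto simp: mono_on_def)

lemma knot_inj: "i \<le> n \<Longrightarrow> j \<le> n \<Longrightarrow> X i = X j \<Longrightarrow> i = j"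
  using strict_mono_on_imp_inj_on[OF knots] by (auto simp: inj_on_def)

lemma ends_less: "X 0 < X n"
  using knots n_pos by (auto simp: strict_mono_on_def)

lemma L_image: "i \<in> {1..n} \<Longrightarrow> L i ` {X 0..X n} = {X (i - 1)..X i}"
  using homeomorphism_image1 L_homeo by blast

lemma L_inj: "i \<in> {1..n} \<Longrightarrow> inj_on (L i) {X 0..X n}"
proof -
  assume "i \<in> {1..n}"
  then obtain L' where "homeomorphism {X 0..X n} {X (i - 1)..X i} (L i) L'"
    using L_homeo by blast
  then show ?thesis
    by (intro inj_on_inverseI) (rule homeomorphism_apply1)
qed

lemma L_images_cover: "(\<Union>i\<in>{1..n}. L i ` {X 0..X n}) = {X 0..X n}"
proof
  show "(\<Union>i\<in>{1..n}. L i ` {X 0..X n}) \<subseteq> {X 0..X n}"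
  proof (rule UN_least)
    fix i assume "i \<in> {1..n}"
    then show "L i ` {X 0..X n} \<subseteq> {X 0..X n}"
      using knot_le[of 0 "i - 1"] knot_le[of i n] by (auto simp: L_image)
  qed
  show "{X 0..X n} \<subseteq> (\<Union>i\<in>{1..n}. L i ` {X 0..X n})"
    using Icc_subset_Union_knots[OF n_pos, of X] by (simp add: L_image)
qed

text \<open>
  Two different subintervals meet at most in a knot, which is the image of \<open>X n\<close> from the left and
  of \<open>X 0\<close> from the right; there the endpoint conditions prescribe the same value of \<open>Y\<close>.
\<close>

lemma pieces_agree_less:
  assumes h: "h (X 0) = Y 0" "h (X n) = Y n"
    and i: "i \<in> {1..n}" "j \<in> {1..n}" "i < j"
    and s: "s \<in> {X 0..X n}" "s' \<in> {X 0..X n}" and eq: "L i s = L j s'"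
  shows "F i (s, h s) = F j (s', h s')"
proof -
  have "L i s \<le> X i" "X (j - 1) \<le> L j s'"
    using L_image[OF i(1)] L_image[OF i(2)] s by auto
  moreover have "X i \<le> X (j - 1)"
    using i by (intro knot_le) auto
  ultimately have knot: "L i s = X i" "L j s' = X (j - 1)" "X i = X (j - 1)"
    using eq by linarith+
  have "i = j - 1"
    using i by (intro knot_inj knot(3)) auto
  moreover have "s = X n"
    by (rule inj_onD[OF L_inj[OF i(1)] _ s(1)]) (simp_all add: knot(1) L_right[OF i(1)] ends_less less_imp_le)
  moreover have "s' = X 0"
    by (rule inj_onD[OF L_inj[OF i(2)] _ s(2)]) (simp_all add: knot(2) L_left[OF i(2)] ends_less less_imp_le)
  ultimately show ?thesis
    using F_right[OF i(1)] F_left[OF i(2)] h by simp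
qed

lemma pieces_agree:
  assumes h: "h (X 0) = Y 0" "h (X n) = Y n"
    and i: "i \<in> {1..n}" "j \<in> {1..n}"
    and s: "s \<in> {X 0..X n}" "s' \<in> {X 0..X n}" and eq: "L i s = L j s'"
  shows "F i (s, h s) = F j (s', h s')"
proof (cases i j rule: linorder_cases)
  case less
  then show ?thesis using pieces_agree_less[where h = h, OF h i _ s eq] by simp
next
  case equal
  then have "s = s'"
    using eq inj_onD[OF L_inj[OF i(2)] _ s] by simp
  with equal show ?thesis by simp
next
  case greater
  then show ?thesis using pieces_agree_less[where h = h, OF h i(2,1) _ s(2,1) eq[symmetric]] by simp
qed

text \<open>
  This \<open>u\<close> is the image of \<open>h\<close> under the Read--Bajraktarevic operator.  It is well defined because
  the pieces agree, and continuous because it is continuous on each of finitely many closed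
  subintervals, where it is \<open>F i (_, h _)\<close> composed with the continuous inverse of \<open>L i\<close>.
\<close>

lemma exists_glued_function:
  assumes h_cont: "continuous_on {X 0..X n} h" and h: "h (X 0) = Y 0" "h (X n) = Y n"
  obtains u where "continuous_on {X 0..X n} u" "u (X 0) = Y 0" "u (X n) = Y n"
    "\<And>i s. i \<in> {1..n} \<Longrightarrow> s \<in> {X 0..X n} \<Longrightarrow> u (L i s) = F i (s, h s)"
proof -
  define u where "u t = (SOME z. \<exists>i\<in>{1..n}. \<exists>s\<in>{X 0..X n}. t = L i s \<and> z = F i (s, h s))" for t
  have u_L: "u (L i s) = F i (s, h s)" if "i \<in> {1..n}" "s \<in> {X 0..X n}" for i s
    unfolding u_def
  proof (rule some_equality)
    show "\<exists>j\<in>{1..n}. \<exists>r\<in>{X 0..X n}. L i s = L j r \<and> F i (s, h s) = F j (r, h r)"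
      using that by blast
  next
    fix z assume "\<exists>j\<in>{1..n}. \<exists>r\<in>{X 0..X n}. L i s = L j r \<and> z = F j (r, h r)"
    then obtain j r where "j \<in> {1..n}" "r \<in> {X 0..X n}" "L i s = L j r" "z = F j (r, h r)"
      by blast
    then show "z = F i (s, h s)"
      by (simp only: pieces_agree[where h = h, OF h that(1) _ that(2)])
  qed
  have "continuous_on (\<Union>i\<in>{1..n}. {X (i - 1)..X i}) u"
  proof (rule continuous_on_closed_Union)
    fix i assume i: "i \<in> {1..n}"
    then obtain L' where L': "homeomorphism {X 0..X n} {X (i - 1)..X i} (L i) L'"
      using L_homeo by blast
    then have L'_cont: "continuous_on {X (i - 1)..X i} L'"
      and L'_im: "L' ` {X (i - 1)..X i} = {X 0..X n}"
      and LL': "\<And>t. t \<in> {X (i - 1)..X i} \<Longrightarrow> L i (L' t) = t"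
      by (simp_all only: homeomorphism_def)
    have "continuous_on {X (i - 1)..X i} (\<lambda>t. F i (L' t, h (L' t)))"
    proof (rule continuous_on_compose2[OF F_cont[OF i]])
      have "continuous_on {X (i - 1)..X i} (\<lambda>t. h (L' t))"
        by (rule continuous_on_compose2[OF h_cont L'_cont]) (rule equalityD1[OF L'_im])
      then show "continuous_on {X (i - 1)..X i} (\<lambda>t. (L' t, h (L' t)))"
        by (intro continuous_on_Pair L'_cont)
      show "(\<lambda>t. (L' t, h (L' t))) ` {X (i - 1)..X i} \<subseteq> {X 0..X n} \<times> UNIV"
        using L'_im by blast
    qed
    moreover have "F i (L' t, h (L' t)) = u t" if t: "t \<in> {X (i - 1)..X i}" for t
    proof -
      have "L' t \<in> {X 0..X n}"
        using t L'_im by blast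
      from u_L[OF i this] show ?thesis
        using LL'[OF t] by simp
    qed
    ultimately show "continuous_on {X (i - 1)..X i} u"
      by (rule continuous_on_eq)
  qed simp_all
  then have "continuous_on {X 0..X n} u"
    by (rule continuous_on_subset) (rule Icc_subset_Union_knots[OF n_pos])
  moreover have "u (X 0) = Y 0"
    using u_L[of 1 "X 0"] L_left[of 1] F_left[of 1] n_pos ends_less h by simp
  moreover have "u (X n) = Y n"
    using u_L[of n "X n"] L_right[of n] F_right[of n] n_pos ends_less h by simp
  ultimately show ?thesis
    by (rule that[OF _ _ _ u_L])
qed

lemma exists_uniform_factor:
  obtains B where "0 \<le> B" "B < 1" "\<And>i. i \<in> {1..n} \<Longrightarrow> \<bar>b i\<bar> \<le> B"
proof
  let ?B = "Max ((\<lambda>i. \<bar>b i\<bar>) ` {1..n})"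
  show le: "\<bar>b i\<bar> \<le> ?B" if "i \<in> {1..n}" for i
    using that by (intro Max_ge) auto
  show "?B < 1"
    using n_pos b_less_1 by (subst Max_less_iff) auto
  show "0 \<le> ?B"
  proof (rule order_trans)
    show "0 \<le> \<bar>b 1\<bar>"
      by (rule abs_ge_zero)
    show "\<bar>b 1\<bar> \<le> ?B"
      using n_pos by (intro le) simp
  qed
qed

text \<open>
  Banach's theorem is applied in the complete space of bounded continuous functions on the whole
  line; functions on the interval are extended to be constant on both sides of it.
\<close>

lemma exists_self_referential_function:
  obtains g where "continuous_on {X 0..X n} g" "g (X 0) = Y 0" "g (X n) = Y n"
    "\<And>i s. i \<in> {1..n} \<Longrightarrow> s \<in> {X 0..X n} \<Longrightarrow> g (L i s) = F i (s, g s)"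
proof -
  define S :: "(real \<Rightarrow>\<^sub>C real) set" where "S = 
    {h. apply_bcontfun h (X 0) = Y 0 \<and> apply_bcontfun h (X n) = Y n}"
  define glues :: "(real \<Rightarrow>\<^sub>C real) \<Rightarrow> (real \<Rightarrow>\<^sub>C real) \<Rightarrow> bool" where "glues h u \<longleftrightarrow>
      (\<forall>i\<in>{1..n}. \<forall>s\<in>{X 0..X n}. u (L i s) = F i (s, h s)) \<and>
      (\<forall>t. u t = u (clamp (X 0) (X n) t))" for h u
  have "\<exists>u\<in>S. glues h u" if hS: "h \<in> S" for h
  proof -
    obtain v where v: "continuous_on {X 0..X n} v" "v (X 0) = Y 0" "v (X n) = Y n"
      "\<And>i s. i \<in> {1..n} \<Longrightarrow> s \<in> {X 0..X n} \<Longrightarrow> v (L i s) = F i (s, h s)"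
    proof (rule exists_glued_function)
      show "continuous_on {X 0..X n} h"
        by (rule continuous_on_apply_bcontfun)
      show "h (X 0) = Y 0" "h (X n) = Y n"
        using hS by (simp_all add: S_def)
    qed (rule that)
    obtain u :: "real \<Rightarrow>\<^sub>C real" where u: "\<And>t. t \<in> {X 0..X n} \<Longrightarrow> u t = v t"
      "\<And>t. u t = v (clamp (X 0) (X n) t)"
      using continuous_on_cbox_bcontfunE[of "X 0" "X n" v] v(1) by (auto simp: cbox_interval)
    have "u (L i s) = F i (s, h s)" if "i \<in> {1..n}" "s \<in> {X 0..X n}" for i s
    proof -
      have "L i s \<in> {X 0..X n}"
        using that L_images_cover by blast
      then have "u (L i s) = v (L i s)"
        by (rule u(1))
      also have "\<dots> = F i (s, h s)"
        using that by (rule v(4))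
      finally show ?thesis .
    qed
    moreover have "u t = u (clamp (X 0) (X n) t)" for t
      using clamp_in_interval[of "X 0" "X n" t] ends_less u(1)[of "clamp (X 0) (X n) t"]
      by (simp add: u(2)[of t] cbox_interval)
    ultimately have "glues h u"
      unfolding glues_def by blast
    moreover have "u \<in> S"
      using u(1) v(2,3) ends_less by (simp add: S_def)
    ultimately show ?thesis by blast
  qed
  then obtain T where T: "\<And>h. h \<in> S \<Longrightarrow> T h \<in> S \<and> glues h (T h)"
    by metis
  obtain B where B: "0 \<le> B" "B < 1" "\<And>i. i \<in> {1..n} \<Longrightarrow> \<bar>b i\<bar> \<le> B"
    by (rule exists_uniform_factor) (rule that)
  have "dist (T h) (T h') \<le> B * dist h h'" if hS: "h \<in> S" "h' \<in> S" for h h'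
  proof (rule dist_bound)
    fix t
    have "clamp (X 0) (X n) t \<in> {X 0..X n}"
      using clamp_in_interval[of "X 0" "X n" t] ends_less by (simp add: cbox_interval)
    then obtain i s where i: "i \<in> {1..n}" "s \<in> {X 0..X n}" "clamp (X 0) (X n) t = L i s"
      using L_images_cover by blast
    have "T h t = F i (s, h s)" "T h' t = F i (s, h' s)"
      using T hS i unfolding glues_def by metis+
    then have "dist (T h t) (T h' t) \<le> \<bar>b i\<bar> * dist (h s) (h' s)"
      using F_lip[OF i(1,2)] by (simp add: dist_real_def)
    also have "\<dots> \<le> B * dist h h'"
      using B(1) B(3)[OF i(1)] dist_bounded by (intro mult_mono) auto
    finally show "dist (T h t) (T h' t) \<le> B * dist h h'" .
  qed
  moreover have "complete S"
  proof -
    have "closed {h :: real \<Rightarrow>\<^sub>C real. h t = z}" for t z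
    proof -
      have "continuous_on UNIV (\<lambda>h :: real \<Rightarrow>\<^sub>C real. h t)"
        by (rule continuous_onI) (metis dist_bounded order_le_less_trans less_imp_le)
      then show ?thesis
        using continuous_closed_vimage[of "{z}"] by (auto simp: continuous_on_eq_continuous_at vimage_def)
    qed
    then have "closed S"
      unfolding S_def by (intro closed_Collect_conj)
    then show ?thesis
      by (simp add: complete_eq_closed)
  qed
  moreover have "S \<noteq> {}"
  proof -
    \<comment> \<open>the affine function through the two prescribed end values\<close>
    define p where "p t = Y 0 + (Y n - Y 0) * ((t - X 0) / (X n - X 0))" for t
    have "continuous_on (cbox (X 0) (X n)) p"
      unfolding p_def using ends_less by (intro continuous_intros) auto
    then obtain h :: "real \<Rightarrow>\<^sub>C real" where "\<And>t. t \<in> cbox (X 0) (X n) \<Longrightarrow> h t = p t"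
      by (rule continuous_on_cbox_bcontfunE) (rule that)
    then have "h \<in> S"
      using ends_less by (simp add: S_def p_def cbox_interval)
    then show ?thesis by blast
  qed
  ultimately obtain g where g: "g \<in> S" "T g = g"
    using Banach_fix[of S B T] B(1,2) T by blast
  have "glues g g"
    using T[OF g(1)] g(2) by simp
  then show ?thesis
    using that[of g] g(1) by (auto simp: S_def glues_def)
qed

end

section \<open>The product system\<close>

text \<open>
  With finitely many coordinates the largest factor is still below \<open>1\<close>, so contraction in each
  coordinate gives contraction in the Euclidean norm.  The statement speaks of arbitrary
  vectors, so that it covers the base maps as well as the fibre maps.
\<close>

lemma componentwise_contraction:
  fixes C :: "'m::finite \<Rightarrow> real"
  assumes "\<And>k. 0 \<le> C k \<and> C k < 1"
  shows "\<exists>D. 0 \<le> D \<and> D < 1 \<and>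
    (\<forall>u u' v v' :: real ^ 'm. (\<forall>k. \<bar>u $ k - u' $ k\<bar> \<le> C k * \<bar>v $ k - v' $ k\<bar>) \<longrightarrow>
      dist u u' \<le> D * dist v v')"
proof (intro exI conjI allI impI)
  let ?D = "Max (range C)"
  have le: "C k \<le> ?D" for k
    by (intro Max_ge) auto
  show D_nonneg: "0 \<le> ?D"
    using assms le order_trans by blast
  show "?D < 1"
    using assms by (subst Max_less_iff) auto
  fix u u' v v' :: "real ^ 'm"
  assume "\<forall>k. \<bar>u $ k - u' $ k\<bar> \<le> C k * \<bar>v $ k - v' $ k\<bar>"
  then have "norm ((u - u') $ k) \<le> norm ((?D *\<^sub>R (v - v')) $ k)" for k
    using mult_right_mono[OF le, of "\<bar>v $ k - v' $ k\<bar>" k] D_nonneg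
    by (auto simp: abs_mult intro: order_trans)
  then have "norm (u - u') \<le> norm (?D *\<^sub>R (v - v'))"
    by (rule norm_le_componentwise_cart)
  then show "dist u u' \<le> ?D * dist v v'"
    using D_nonneg by (simp add: dist_norm)
qed

lemma domain_box_eq_cbox: "domain_box x N = cbox (\<chi> k. x k 0) (\<chi> k. x k (N k))"
  by (auto simp: domain_box_def side_def mem_box_cart)

lemma L_map_images_cover:
  assumes "\<And>k. (\<Union>i\<in>{1..N k}. L k i ` side x N k) = side x N k"
  shows "(\<Union>i\<in>multi_indices N. L_map L i ` domain_box x N) = domain_box x N"
proof
  show "(\<Union>i\<in>multi_indices N. L_map L i ` domain_box x N) \<subseteq> domain_box x N"
    using assms by (fastforce simp: multi_indices_def domain_box_def L_map_def)
  show "domain_box x N \<subseteq> (\<Union>i\<in>multi_indices N. L_map L i ` domain_box x N)"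
  proof
    fix v assume "v \<in> domain_box x N"
    then have "\<exists>i\<in>{1..N k}. \<exists>s\<in>side x N k. v $ k = L k i s" for k
      using equalityD2[OF assms[of k]] by (fastforce simp: domain_box_def)
    then obtain i s where "\<And>k. i k \<in> {1..N k} \<and> s k \<in> side x N k \<and> v $ k = L k (i k) (s k)"
      by metis
    then have "v = L_map L i (\<chi> k. s k)" "i \<in> multi_indices N" "(\<chi> k. s k) \<in> domain_box x N"
      by (auto simp: L_map_def multi_indices_def domain_box_def vec_eq_iff)
    then show "v \<in> (\<Union>i\<in>multi_indices N. L_map L i ` domain_box x N)"
      by blast
  qed
qed

lemma continuous_on_product_function:
  assumes "\<And>k. continuous_on (side x N k) (g k)"
  shows "continuous_on (domain_box x N) (product_function g)"
  unfolding product_function_def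
  by (intro continuous_on_vec_lambda continuous_on_compose2[OF assms] continuous_intros)
    (auto simp: domain_box_def)

theorem theorem5p2:
  fixes x y :: "'m::finite \<Rightarrow> nat \<Rightarrow> real"
    and N :: "'m \<Rightarrow> nat"
    and L :: "'m \<Rightarrow> nat \<Rightarrow> real \<Rightarrow> real"
    and F :: "'m \<Rightarrow> nat \<Rightarrow> real \<times> real \<Rightarrow> real"
    and a b c :: "'m \<Rightarrow> nat \<Rightarrow> real"
  assumes N_pos: "\<And>k. 1 \<le> N k"
    and x_mono: "\<And>k. strict_mono_on {0..N k} (x k)"
    and L_homeo: "\<And>k i. i \<in> {1..N k} \<Longrightarrow>
          \<exists>L'. homeomorphism (side x N k) (subside x k i) (L k i) L'"
    and L_left: "\<And>k i. i \<in> {1..N k} \<Longrightarrow> L k i (x k 0) = x k (i - 1)"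
    and L_right: "\<And>k i. i \<in> {1..N k} \<Longrightarrow> L k i (x k (N k)) = x k i"
    and c_range: "\<And>k i. i \<in> {1..N k} \<Longrightarrow> 0 \<le> c k i \<and> c k i < 1"
    and L_contr: "\<And>k i s s'. i \<in> {1..N k} \<Longrightarrow> s \<in> side x N k \<Longrightarrow> s' \<in> side x N k \<Longrightarrow>
          \<bar>L k i s - L k i s'\<bar> \<le> c k i * \<bar>s - s'\<bar>"
    and F_cont: "\<And>k i. i \<in> {1..N k} \<Longrightarrow> continuous_on (side x N k \<times> UNIV) (F k i)"
    and F_left: "\<And>k i. i \<in> {1..N k} \<Longrightarrow> F k i (x k 0, y k 0) = y k (i - 1)"
    and F_right: "\<And>k i. i \<in> {1..N k} \<Longrightarrow> F k i (x k (N k), y k (N k)) = y k i"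
    and a_range: "\<And>k i. i \<in> {1..N k} \<Longrightarrow> a k i \<in> {-1<..<1}"
    and b_range: "\<And>k i. i \<in> {1..N k} \<Longrightarrow> b k i \<in> {-1<..<1}"
    and F_lip_x: "\<And>k i s s' t. i \<in> {1..N k} \<Longrightarrow> s \<in> side x N k \<Longrightarrow> s' \<in> side x N k \<Longrightarrow>
          \<bar>F k i (s, t) - F k i (s', t)\<bar> \<le> \<bar>a k i\<bar> * \<bar>s - s'\<bar>"
    and F_lip_y: "\<And>k i s t t'. i \<in> {1..N k} \<Longrightarrow> s \<in> side x N k \<Longrightarrow>
          \<bar>F k i (s, t) - F k i (s, t')\<bar> \<le> \<bar>b k i\<bar> * \<bar>t - t'\<bar>"
  shows "\<exists>g :: 'm \<Rightarrow> real \<Rightarrow> real.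
           product_function g \<in> product_class x y N \<and>
           continuous_on (domain_box x N) (product_function g) \<and>
           attractor (domain_box x N \<times> UNIV) (multi_indices N) (W_map L F)
             = graph_on (domain_box x N) (product_function g)"
proof -
  have sys: "interpolation_system (x k) (y k) (N k) (L k) (F k) (b k)" for k
  proof
    show "\<bar>b k i\<bar> < 1" if "i \<in> {1..N k}" for i
      using b_range[OF that] by (auto simp: abs_less_iff)
  qed (fact N_pos x_mono L_left L_right F_left F_right
      L_homeo[unfolded side_def subside_def] F_cont[unfolded side_def] F_lip_y[unfolded side_def])+
  have "\<exists>g. continuous_on (side x N k) g \<and> g (x k 0) = y k 0 \<and> g (x k (N k)) = y k (N k) \<and>
      (\<forall>i\<in>{1..N k}. \<forall>s\<in>side x N k. g (L k i s) = F k i (s, g s))" for k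
    using interpolation_system.exists_self_referential_function[OF sys[of k]]
    unfolding side_def by metis
  then obtain g where g: "\<And>k. continuous_on (side x N k) (g k)"
      "\<And>k. g k (x k 0) = y k 0" "\<And>k. g k (x k (N k)) = y k (N k)"
    and g_eqn: "\<And>k i s. i \<in> {1..N k} \<Longrightarrow> s \<in> side x N k \<Longrightarrow> g k (L k i s) = F k i (s, g k s)"
    by metis
  have cont: "continuous_on (domain_box x N) (product_function g)"
    by (rule continuous_on_product_function) (rule g(1))
  have W_eq: "W_map L F = (\<lambda>i (v, w). (L_map L i v, F_map F i v w))"
    by (simp add: W_map_def fun_eq_iff)
  have "attractor (domain_box x N \<times> UNIV) (multi_indices N) (W_map L F)
      = graph_on (domain_box x N) (product_function g)"
    unfolding W_eq
  proof (rule attractor_skew_product_eq_graph[OF _ _ _ cont])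
    show "compact (domain_box x N)"
      by (simp add: domain_box_eq_cbox)
    have "(\<chi> k. x k 0) \<in> domain_box x N"
      using interpolation_system.ends_less[OF sys] by (auto simp: domain_box_def side_def less_imp_le)
    then show "domain_box x N \<noteq> {}"
      by blast
    show "(\<Union>i\<in>multi_indices N. L_map L i ` domain_box x N) = domain_box x N"
      using interpolation_system.L_images_cover[OF sys]
      by (intro L_map_images_cover) (simp add: side_def)
  next
    fix i v assume "i \<in> multi_indices N" "v \<in> domain_box x N"
    then have iv: "i k \<in> {1..N k}" "v $ k \<in> side x N k" for k
      by (auto simp: multi_indices_def domain_box_def)
    show "product_function g (L_map L i v) = F_map F i v (product_function g v)"
      using g_eqn[OF iv] by (simp add: product_function_def L_map_def F_map_def)
    obtain D where D: "0 \<le> D" "D < 1" and contr: "\<And>u u' w w' :: real ^ 'm.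
        (\<forall>k. \<bar>u $ k - u' $ k\<bar> \<le> \<bar>b k (i k)\<bar> * \<bar>w $ k - w' $ k\<bar>) \<Longrightarrow> dist u u' \<le> D * dist w w'"
      using componentwise_contraction[of "\<lambda>k. \<bar>b k (i k)\<bar>"] b_range[OF iv(1)]
      by (auto simp: abs_less_iff minus_less_iff)
    have "dist (F_map F i v w) (F_map F i v w') \<le> D * dist w w'" for w w'
      by (rule contr) (simp add: F_map_def F_lip_y[OF iv])
    with D show "\<exists>D. 0 \<le> D \<and> D < 1 \<and>
        (\<forall>w w'. dist (F_map F i v w) (F_map F i v w') \<le> D * dist w w')"
      by blast
  next
    fix i assume "i \<in> multi_indices N"
    then have i: "i k \<in> {1..N k}" for k
      by (auto simp: multi_indices_def)
    obtain D where D: "0 \<le> D" "D < 1" and contr: "\<And>u u' v v' :: real ^ 'm.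
        (\<forall>k. \<bar>u $ k - u' $ k\<bar> \<le> c k (i k) * \<bar>v $ k - v' $ k\<bar>) \<Longrightarrow> dist u u' \<le> D * dist v v'"
      using componentwise_contraction[of "\<lambda>k. c k (i k)"] c_range[OF i] by auto
    have "dist (L_map L i u) (L_map L i v) \<le> D * dist u v"
      if "u \<in> domain_box x N" "v \<in> domain_box x N" for u v
      using that by (intro contr) (auto simp: L_map_def domain_box_def intro!: L_contr[OF i])
    with D show "\<exists>D. 0 \<le> D \<and> D < 1 \<and>
        (\<forall>u\<in>domain_box x N. \<forall>v\<in>domain_box x N.
          dist (L_map L i u) (L_map L i v) \<le> D * dist u v)"
      by blast
  qed
  moreover have "product_function g \<in> product_class x y N"
    using g by (auto simp: product_class_def cont_interp_def)
  ultimately show ?thesis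
    using cont by blast
qed

end
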